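(* Let $U\subseteq\mathbb{R}^m$ be a nonempty compact convex set, and let $F:U\to\mathbb{R}^m$, with $F(u)=\mathbb{E}[\Phi(u,\xi)]$ for all $u\in U$, be continuous. Let $U^*$ be the solution set of the variational inequality VI$(U,F)$, assumed nonempty and closed. Let the constants $M_U>0$ and $D>0$ be such that $\|u-u'\|\le M_U$ for all $u,u'\in U$ and $\|F(u)\|\le D$ for all $u\in U$. Assume that: (i) for some $\sigma>0$ and all $k\ge 0$, $\mathbb{E}[\Phi(h_k,\xi_k)-F(h_k)\mid h_k]=0$ and $\mathbb{E}[\|\Phi(h_k,\xi_k)-F(h_k)\|^2\mid h_k]\le\sigma^2$; (ii) $F$ is $p$-quasi sharp over $U$ relative to $U^*$ with $0<p\le 2$: for some $\mu>0$, $\langle F(u),u-u^*\rangle\ge\mu\,\mathrm{dist}^p(u,U^* )$ for all $u\in U$ and all $u^*\in U^*$. Then for the iterate sequence $\{u_k\}$ generated by the stochastic Popov method the following hold: (a) Let the stepsizes be $\alpha_k=\frac{2M_U^{2-p}}{\mu(3+k)}$ for all $k\ge 0$. Then for all $K\ge 2$, $$\mathbb{E}[\mathrm{dist}^2(u_{K+1},U^* )]\le\frac{32}{(K-1)^2}\,\mathbb{E}[\mathrm{dist}^2(u_1,U^* )]+\frac{24(\sigma^2+2D^2)M_U^{2(2-p)}}{\mu^2(K-1)}.$$ (b) For any $K\ge 2$, let the stepsizes $\alpha_k$, $0\le k\le K$, be given by the $(a,d,K)$-stepsize rule (defined in the context) with $a=\frac{\mu}{M_U^{2-p}}$ and $d=\frac{2\mu}{M_U^{2-p}}$.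 Then for all $K\ge 2$, $$\mathbb{E}[\mathrm{dist}^2(u_{K+1},U^* )]\le 64\,\mathbb{E}[\mathrm{dist}^2(u_1,U^* )]\,e^{-\frac{K-1}{4}}+\frac{432(\sigma^2+2D^2)M_U^{2(2-p)}}{\mu^2(K-1)}.$$
   Context: The variational inequality VI$(U,F)$ is the problem of finding $u^*\in U$ with $\langle F(u^* ),u-u^*\rangle\ge 0$ for all $u\in U$; $U^*$ is the set of all such $u^*$. $\|\cdot\|$ is the Euclidean norm, $P_U(u)=\arg\min_{v\in U}\|v-u\|$ is the projection onto $U$, $\mathrm{dist}(u,Y)=\inf_{y\in Y}\|u-y\|$, and $\mathrm{dist}^p(u,Y)=(\mathrm{dist}(u,Y))^p$. Here $\Phi:U\times\mathbb{R}^d\to\mathbb{R}^m$ is a stochastic operator and $\xi$ is a $d$-dimensional random vector (this dimension $d$ is unrelated to the stepsize parameter $d$). Stochastic Popov method: given arbitrary deterministic points $u_0,h_0\in U$ and stepsizes $\alpha_k>0$, at each iteration $k\ge 0$, having $h_k$, a random sample $\xi_k$ is drawn according to the distribution of $\xi$, and $$u_{k+1}=P_U(u_k-\alpha_k\Phi(h_k,\xi_k)),\qquad h_{k+1}=P_U(u_{k+1}-\alpha_{k+1}\Phi(h_k,\xi_k)).$$ The $(a,d,K)$-stepsize rule, for real $d\ge a>0$ and an integer $K\ge 0$: with $k_0=\lceil K/2\rceil$, for $0\le k\le K$, $$\alpha_k=\frac1d\ \text{ if }K\le\frac da;\qquad \alpha_k=\frac1d\ \text{ if }K>\frac da\text{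 and }k<k_0;\qquad \alpha_k=\frac{2}{a\left(\frac{2d}{a}+k-k_0\right)}\ \text{ if }K>\frac da\text{ and }k\ge k_0.$$ *)

theory Defs
  imports "HOL-Probability.Probability"
begin

definition VI_solutions :: "(real^'m) set \<Rightarrow> (real^'m \<Rightarrow> real^'m) \<Rightarrow> (real^'m) set" where
  "VI_solutions U F = {v \<in> U. \<forall>u\<in>U. F v \<bullet> (u - v) \<ge> 0}"

definition quasi_sharp ::
    "real \<Rightarrow> real \<Rightarrow> (real^'m) set \<Rightarrow> (real^'m) set \<Rightarrow> (real^'m \<Rightarrow> real^'m) \<Rightarrow> bool" where
  "quasi_sharp p \<mu> U S F \<longleftrightarrow>
     (\<forall>u\<in>U. \<forall>v\<in>S. F u \<bullet> (u - v) \<ge> \<mu> * infdist u S powr p)"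

text \<open>
  One run of the Popov method along a fixed sequence \<open>x\<close> of samples; the result at \<open>k\<close> is
  the pair of \<open>u k\<close> and \<open>h k\<close>. The projection onto \<open>U\<close> is \<^const>\<open>closest_point\<close>.
\<close>

primrec popov ::
    "(real^'m) set \<Rightarrow> (real^'m \<Rightarrow> real^'d \<Rightarrow> real^'m) \<Rightarrow> (nat \<Rightarrow> real) \<Rightarrow>
     real^'m \<Rightarrow> real^'m \<Rightarrow> (nat \<Rightarrow> real^'d) \<Rightarrow> nat \<Rightarrow> (real^'m) \<times> (real^'m)" where
  "popov U \<Phi> \<alpha> u0 h0 x 0 = (u0, h0)"
| "popov U \<Phi> \<alpha> u0 h0 x (Suc k) =
    (let (u, h) = popov U \<Phi> \<alpha> u0 h0 x k;
         u' = closest_point U (u - \<alpha> k *\<^sub>R \<Phi> h (x k));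
         h' = closest_point U (u' - \<alpha> (Suc k) *\<^sub>R \<Phi> h (x k))
     in (u', h'))"

definition popov_u where
  "popov_u U \<Phi> \<alpha> u0 h0 x k = fst (popov U \<Phi> \<alpha> u0 h0 x k)"

definition popov_h where
  "popov_h U \<Phi> \<alpha> u0 h0 x k = snd (popov U \<Phi> \<alpha> u0 h0 x k)"

text \<open>
  The two moment conditions on the error \<open>\<Phi>(h,\<xi>) - F(h)\<close>, conditional on the random point
  \<open>h\<close>. The conditional mean of the vector-valued error is taken componentwise, since
  \<^const>\<open>real_cond_exp\<close> is scalar. The second moment uses \<^const>\<open>nn_cond_exp\<close>, because
  \<^const>\<open>real_cond_exp\<close> may be \<open>0\<close> where the conditional expectation is infinite; the bound
  therefore also makes the error square integrable.
\<close>

definition unbiased_bounded_noise ::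
    "'w measure \<Rightarrow> (real^'m \<Rightarrow> real^'d \<Rightarrow> real^'m) \<Rightarrow> (real^'m \<Rightarrow> real^'m) \<Rightarrow> real \<Rightarrow>
     ('w \<Rightarrow> real^'m) \<Rightarrow> ('w \<Rightarrow> real^'d) \<Rightarrow> bool" where
  "unbiased_bounded_noise M \<Phi> F \<sigma> h \<xi> \<longleftrightarrow>
    (let G = vimage_algebra (space M) h borel;
         e = (\<lambda>\<omega>. \<Phi> (h \<omega>) (\<xi> \<omega>) - F (h \<omega>))
     in (\<forall>i. AE \<omega> in M. real_cond_exp M G (\<lambda>\<omega>. e \<omega> $ i) \<omega> = 0) \<and>
        (AE \<omega> in M. nn_cond_exp M G (\<lambda>\<omega>. ennreal ((norm (e \<omega>))\<^sup>2)) \<omega> \<le> ennreal (\<sigma>\<^sup>2)))"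

definition adK_stepsize :: "real \<Rightarrow> real \<Rightarrow> nat \<Rightarrow> nat \<Rightarrow> real" where
  "adK_stepsize a d K k =
    (let k0 = nat \<lceil>real K / 2\<rceil>
     in if real K \<le> d / a \<or> k < k0 then 1 / d
        else 2 / (a * (2 * d / a + real k - real k0)))"

end

theory Submission
  imports Defs
begin

text \<open>
  The projection inequalities for the two half-steps give, for every \<open>y \<in> U\<close>,
  \<open>|u' - y|\<^sup>2 \<le> |u - y|\<^sup>2 - |u - h|\<^sup>2 - 2 \<alpha> g \<bullet> (h - y) + \<alpha>\<^sup>2 |g - g'|\<^sup>2\<close>,
  where \<open>g\<close> and \<open>g'\<close> are the current and the previous operator sample. Quasi-sharpness makes every
  solution a Minty solution, so the solution set is convex and \<open>y\<close> can be taken as the (measurable)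
  projection of \<open>u\<close> onto it. With \<open>a = \<mu> / M\<^sub>U powr (2 - p)\<close>, quasi-sharpness also yields
  \<open>F h \<bullet> (h - y) \<ge> a dist\<^sup>2(h, U*)\<close>. Taking expectations, the noise term vanishes by
  independence of the samples, and for \<open>2 a \<alpha> k \<le> 1\<close>
  \<open>r (k + 1) \<le> (1 - a \<alpha> k) r k + 6 (\<alpha> k)\<^sup>2 (\<sigma>\<^sup>2 + 2 D\<^sup>2)\<close> holds for the expected squared distances \<open>r\<close>
  and \<open>k \<ge> 1\<close>. Both rates follow by solving this recursion: with \<open>1 - a \<alpha> = 1 - 2 / (j + 4)\<close>
  multiplication by \<open>(j + 3) (j + 4)\<close> makes it telescope, and with \<open>a \<alpha> = 1 / 2\<close> it is geometric.
\<close>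

section \<open>Deterministic inequalities for one step\<close>

text \<open>The projection defining \<open>h\<close> is tested at \<open>u'\<close>, the one
  defining \<open>u'\<close> at \<open>y\<close>. Expanding the squares leaves the cross term
  \<open>2 * \<alpha> * ((g - g') \<bullet> (h - u'))\<close> and
  \<open>- (norm (h - u'))\<^sup>2\<close>.\<close>

lemma popov_step_inequality:
  fixes U :: "'a::euclidean_space set"
  assumes U: "convex U" "closed U" and y: "y \<in> U"
    and h: "h = closest_point U (u - \<alpha> *\<^sub>R g')" and u': "u' = closest_point U (u - \<alpha> *\<^sub>R g)"
  shows "(norm (u' - y))\<^sup>2 \<le>
    (norm (u - y))\<^sup>2 - (norm (u - h))\<^sup>2 - 2 * \<alpha> * (g \<bullet> (h - y)) + \<alpha>\<^sup>2 * (norm (g - g'))\<^sup>2"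
proof -
  have "u' \<in> U"
    unfolding u' using closest_point_in_set[OF U(2)] y by blast
  then have 1: "(u - \<alpha> *\<^sub>R g' - h) \<bullet> (u' - h) \<le> 0"
    unfolding h by (rule closest_point_dot[OF U])
  have 2: "(u - \<alpha> *\<^sub>R g - u') \<bullet> (y - u') \<le> 0"
    unfolding u' by (rule closest_point_dot[OF U y])
  \<comment> \<open>Completing the square: this bounds the cross term minus
    \<open>(norm (h - u'))\<^sup>2\<close> by
    \<open>\<alpha>\<^sup>2 * (norm (g - g'))\<^sup>2\<close>.\<close>
  have 3: "0 \<le> (\<alpha> *\<^sub>R (g - g') - (h - u')) \<bullet> (\<alpha> *\<^sub>R (g - g') - (h - u'))"
    by simp
  show ?thesis
    using 1 2 3 unfolding power2_norm_eq_inner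
    by (simp add: inner_diff_left inner_diff_right inner_commute power2_eq_square algebra_simps)
qed

text \<open>Two consecutive samples differ by their two errors and by \<open>f - f'\<close>, whose
  norm is at most \<open>2 * D\<close>; the factor 3 is the price of squaring a sum of three
  terms.\<close>

lemma norm_noise_difference_le:
  fixes g g' f f' :: "'a::real_inner"
  assumes "norm f \<le> D" "norm f' \<le> D"
  shows "(norm (g - g'))\<^sup>2 \<le> 3 * ((norm (g - f))\<^sup>2 + (norm (g' - f'))\<^sup>2 + 4 * D\<^sup>2)"
proof -
  define x y z where "x = norm (g - f)" and "y = norm (g' - f')" and "z = norm (f - f')"
  have "norm (g - g') \<le> x + y + z"
    unfolding x_def y_def z_def
    using norm_triangle_ineq[of "g - f" "f - g'"] norm_triangle_ineq[of "f - f'" "f' - g'"]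
    by (simp add: norm_minus_commute)
  then have "(norm (g - g'))\<^sup>2 \<le> (x + y + z)\<^sup>2"
    by (simp add: power_mono)
  also have "\<dots> \<le> 3 * (x\<^sup>2 + y\<^sup>2 + z\<^sup>2)"
    using zero_le_power2[of "x - y"] zero_le_power2[of "y - z"] zero_le_power2[of "x - z"]
    by (simp add: power2_eq_square algebra_simps)
  also have "z\<^sup>2 \<le> (2 * D)\<^sup>2"
    unfolding z_def using assms norm_triangle_ineq4[of f f'] by (intro power_mono) auto
  finally show ?thesis
    by (simp add: x_def y_def power_mult_distrib)
qed

text \<open>Quasi-sharpness is applied at \<open>h\<close>, while the recursion runs over the
  distance of \<open>u\<close>. The extra \<open>norm (u - h)\<close> is later paid for by the
  negative term of the step inequality.\<close>

lemma power2_infdist_le: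
  fixes S :: "'a::real_normed_vector set"
  shows "(infdist u S)\<^sup>2 \<le> 2 * (infdist h S)\<^sup>2 + 2 * (norm (u - h))\<^sup>2"
proof -
  have "infdist u S \<le> infdist h S + norm (u - h)"
    using infdist_triangle[of u S h] by (simp add: dist_norm)
  then have "(infdist u S)\<^sup>2 \<le> (infdist h S + norm (u - h))\<^sup>2"
    by (simp add: power_mono infdist_nonneg)
  also have "\<dots> \<le> 2 * (infdist h S)\<^sup>2 + 2 * (norm (u - h))\<^sup>2"
    using zero_le_power2[of "infdist h S - norm (u - h)"]
    by (simp add: power2_eq_square algebra_simps)
  finally show ?thesis .
qed

lemma infdist_closest_point:
  assumes "closed S" "S \<noteq> {}"
  shows "infdist x S = norm (x - closest_point S x)"
  using setdist_closest_point[OF assms, of x] by (simp add: infdist_eq_setdist dist_norm)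

text \<open>Trades the exponent \<open>p\<close> for 2 on a bounded set: the surplus factor
  \<open>x powr (2 - p)\<close> is monotone in \<open>x\<close> because
  \<open>p \<le> 2\<close>.\<close>

lemma power2_le_powr_mult_powr:
  fixes x m p :: real
  assumes "0 \<le> x" "x \<le> m" "p \<le> 2"
  shows "x\<^sup>2 \<le> x powr p * m powr (2 - p)"
proof (cases "x = 0")
  case False
  then have "x\<^sup>2 = x powr p * x powr (2 - p)"
    using assms by (simp add: powr_add[symmetric])
  also have "\<dots> \<le> x powr p * m powr (2 - p)"
    using assms by (intro mult_left_mono powr_mono2) auto
  finally show ?thesis .
qed simp

section \<open>Convexity of the solution set\<close>

text \<open>
  Minty's lemma: moving from \<open>v\<close> towards \<open>u\<close> within \<open>U\<close> and letting the step tend to \<open>0\<close>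
  turns the dual inequality into the primal one.
\<close>

lemma VI_solutions_eq_Minty:
  assumes U: "convex U" and F: "continuous_on U F"
    and mono: "\<And>u v. u \<in> U \<Longrightarrow> v \<in> VI_solutions U F \<Longrightarrow> F u \<bullet> (u - v) \<ge> 0"
  shows "VI_solutions U F = {v \<in> U. \<forall>u\<in>U. F u \<bullet> (u - v) \<ge> 0}"
proof (intro equalityI subsetI)
  fix v assume v: "v \<in> {v \<in> U. \<forall>u\<in>U. F u \<bullet> (u - v) \<ge> 0}"
  have "F v \<bullet> (u - v) \<ge> 0" if u: "u \<in> U" for u
  proof -
    define w where "w t = v + t *\<^sub>R (u - v)" for t :: real
    have wU: "w t \<in> U" if "t \<in> {0..1}" for t
    proof -
      have "w t = (1 - t) *\<^sub>R v + t *\<^sub>R u"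
        by (simp add: w_def algebra_simps)
      then show ?thesis
        using U u v that by (auto intro: convexD_alt)
    qed
    have "continuous_on {0..1} (\<lambda>t. F (w t) \<bullet> (u - v))"
      using wU by (intro continuous_intros continuous_on_compose2[OF F])
        (auto simp: w_def intro!: continuous_intros)
    then have lim: "((\<lambda>t. F (w t) \<bullet> (u - v)) \<longlongrightarrow> F (w 0) \<bullet> (u - v)) (at 0 within {0..1})"
      by (simp add: continuous_on)
    have nt: "at (0::real) within {0..1} \<noteq> bot"
      by (simp add: at_within_Icc_at_right)
    have "eventually (\<lambda>t. F (w t) \<bullet> (u - v) \<ge> 0) (at 0 within {0..1})"
      unfolding eventually_at_filter
    proof (intro always_eventually allI impI)
      fix t :: real assume t: "t \<noteq> 0" "t \<in> {0..1}"
      have "0 \<le> F (w t) \<bullet> (w t - v)"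
        using v wU t by auto
      also have "\<dots> = t * (F (w t) \<bullet> (u - v))"
        by (simp add: w_def)
      finally show "F (w t) \<bullet> (u - v) \<ge> 0"
        using t by (simp add: zero_le_mult_iff)
    qed
    from tendsto_lowerbound[OF lim this nt] show ?thesis
      by (simp add: w_def)
  qed
  then show "v \<in> VI_solutions U F"
    using v by (auto simp: VI_solutions_def)
qed (use mono in \<open>auto simp: VI_solutions_def\<close>)

text \<open>In Minty form \<open>F\<close> is evaluated at \<open>u\<close> rather than at the
  unknown \<open>v\<close>, so each constraint is a half-space in \<open>v\<close>. Convexity is
  what makes the projection onto the solutions continuous, hence measurable.\<close>

lemma convex_VI_solutions:
  assumes U: "convex U" and F: "continuous_on U F"
    and mono: "\<And>u v. u \<in> U \<Longrightarrow> v \<in> VI_solutions U F \<Longrightarrow> F u \<bullet> (u - v) \<ge> 0"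
  shows "convex (VI_solutions U F)"
proof -
  have "convex {v. F u \<bullet> (u - v) \<ge> 0}" for u
    using convex_halfspace_le[of "F u" "F u \<bullet> u"] by (simp add: inner_diff_right)
  then have "convex (U \<inter> (\<Inter>u\<in>U. {v. F u \<bullet> (u - v) \<ge> 0}))"
    by (intro convex_Int U convex_INT)
  also have "U \<inter> (\<Inter>u\<in>U. {v. F u \<bullet> (u - v) \<ge> 0}) = VI_solutions U F"
    using VI_solutions_eq_Minty[OF assms] by auto
  finally show ?thesis .
qed

section \<open>Scalar recursions\<close>

text \<open>After weighting, every step adds at most \<open>C\<close>. The constant 6 comes from the
  first step, where the contraction factor is 1/2 and the weight is 3 * 4.\<close>

lemma harmonic_recursion:
  fixes s :: "nat \<Rightarrow> real"
  assumes step: "\<And>j. j \<le> J \<Longrightarrow> s (Suc j) \<le> (1 - 2 / (real j + 4)) * s j + C / (real j + 4)\<^sup>2"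
    and "0 \<le> C"
  shows "(real J + 3) * (real J + 4) * s (Suc J) \<le> 6 * s 0 + C * (real J + 1)"
  using step
proof (induction J)
  case 0
  have "s (Suc 0) \<le> s 0 / 2 + C / 16"
    using 0[of 0] by simp
  then show ?case
    using \<open>0 \<le> C\<close> by simp
next
  case (Suc J)
  define x where "x = real J"
  have x: "x \<ge> 0" by (simp add: x_def)
  have IH: "(x + 3) * (x + 4) * s (Suc J) \<le> 6 * s 0 + C * (x + 1)"
    using Suc by (simp add: x_def)
  have "s (Suc (Suc J)) \<le> (1 - 2 / (x + 5)) * s (Suc J) + C / (x + 5)\<^sup>2"
    using Suc.prems[of "Suc J"] by (simp add: x_def add.commute)
  then have "(x + 4) * (x + 5) * s (Suc (Suc J)) \<le>
      (x + 4) * (x + 5) * ((1 - 2 / (x + 5)) * s (Suc J) + C / (x + 5)\<^sup>2)"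
    using x by (intro mult_left_mono) auto
  \<comment> \<open>The contraction factor is \<open>(x + 3) / (x + 5)\<close>, so it turns the new
    weight into the old one.\<close>
  also have "\<dots> = (x + 3) * (x + 4) * s (Suc J) + C * ((x + 4) / (x + 5))"
  proof -
    define y where "y = x + 5"
    have "y \<noteq> 0" "x = y - 5"
      using x by (auto simp: y_def)
    then show ?thesis
      by (simp add: power2_eq_square) (simp add: algebra_simps add_divide_distrib diff_divide_distrib)
  qed
  also have "\<dots> \<le> (6 * s 0 + C * (x + 1)) + C * 1"
    using x IH \<open>0 \<le> C\<close> by (intro add_mono mult_left_mono) auto
  finally show ?case
    by (simp add: x_def algebra_simps)
qed

text \<open>\<open>2 * C\<close> is the fixed point of the map sending \<open>t\<close> to
  \<open>t / 2 + C\<close>, and the signed excess over it is at least halved in each step.\<close>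

lemma geometric_recursion:
  fixes s :: "nat \<Rightarrow> real"
  assumes "\<And>j. j < n \<Longrightarrow> s (Suc j) \<le> s j / 2 + C"
  shows "s n \<le> s 0 / 2 ^ n + 2 * C * (1 - 1 / 2 ^ n)"
  using assms
proof (induction n)
  case (Suc n)
  have "s (Suc n) \<le> s n / 2 + C"
    using Suc.prems by simp
  also have "s n \<le> s 0 / 2 ^ n + 2 * C * (1 - 1 / 2 ^ n)"
    using Suc by simp
  finally show ?case
    by (simp add: field_simps)
qed simp

text \<open>Follows from \<open>exp (1 / 2) \<le> 2\<close>. Applied to roughly \<open>K / 2\<close>
  halvings, it produces the exponent \<open>(K - 1) / 4\<close>.\<close>

lemma half_power_le_exp: "(1 / 2) ^ n \<le> exp (- (real n / 2))"
proof -
  have "exp (1 / 2 :: real) \<le> 2"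
    using exp_bound_half[of "1/2::real"] by simp
  then have "1 / 2 \<le> exp (- (1 / 2) :: real)"
    by (simp add: exp_minus field_simps)
  then have "(1 / 2) ^ n \<le> exp (- (1 / 2) :: real) ^ n"
    by (rule power_mono) simp
  also have "\<dots> = exp (- (real n / 2))"
    by (simp flip: exp_of_nat_mult)
  finally show ?thesis .
qed

section \<open>Independence and conditional expectation\<close>

text \<open>Independence makes the joint law a product, so Fubini allows integrating over
  \<open>Y\<close> first with \<open>X\<close> frozen.\<close>

lemma expectation_indep_var_eq_0:
  fixes f :: "'b \<times> 'b \<Rightarrow> real"
  assumes M: "prob_space M" and indep: "prob_space.indep_var M N X L Y"
    and f [measurable]: "f \<in> borel_measurable (N \<Otimes>\<^sub>M L)"
    and int: "integrable M (\<lambda>\<omega>. f (X \<omega>, Y \<omega>))"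
    and zero: "\<And>x. x \<in> space N \<Longrightarrow> integral\<^sup>L M (\<lambda>\<omega>. f (x, Y \<omega>)) = 0"
  shows "integral\<^sup>L M (\<lambda>\<omega>. f (X \<omega>, Y \<omega>)) = 0"
proof -
  interpret prob_space M by (rule M)
  have X [measurable]: "X \<in> measurable M N" and Y [measurable]: "Y \<in> measurable M L"
    and joint: "distr M N X \<Otimes>\<^sub>M distr M L Y = distr M (N \<Otimes>\<^sub>M L) (\<lambda>\<omega>. (X \<omega>, Y \<omega>))"
    using indep unfolding indep_var_distribution_eq by auto
  interpret X: prob_space "distr M N X" by (rule prob_space_distr) fact
  interpret Y: prob_space "distr M L Y" by (rule prob_space_distr) fact
  interpret XY: pair_sigma_finite "distr M N X" "distr M L Y" ..
  have "expectation (\<lambda>\<omega>. f (X \<omega>, Y \<omega>)) = integral\<^sup>L (distr M N X \<Otimes>\<^sub>M distr M L Y) f"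
    unfolding joint by (simp add: integral_distr)
  also have "\<dots> = (\<integral>x. (\<integral>y. f (x, y) \<partial>distr M L Y) \<partial>distr M N X)"
    by (rule XY.integral_fst'[symmetric]) (simp add: joint integrable_distr_eq int)
  also have "\<dots> = (\<integral>x. 0 \<partial>distr M N X)"
    by (rule Bochner_Integration.integral_cong) (simp_all add: integral_distr zero)
  finally show ?thesis by simp
qed

text \<open>Integrates the conditional bound. As the conditional expectation takes values in the
  extended nonnegative reals, finiteness of the integral is a conclusion here.\<close>

lemma nn_cond_exp_AE_bound:
  fixes f :: "'a \<Rightarrow> real"
  assumes M: "prob_space M" and sub: "subalgebra M G" and f [measurable]: "f \<in> borel_measurable M"
    and nonneg: "\<And>\<omega>. 0 \<le> f \<omega>" "0 \<le> c"
    and bound: "AE \<omega> in M. nn_cond_exp M G (\<lambda>\<omega>. ennreal (f \<omega>)) \<omega> \<le> ennreal c"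
  shows "integrable M f" and "integral\<^sup>L M f \<le> c"
proof -
  interpret prob_space M by (rule M)
  interpret finite_measure_subalgebra M G
    by unfold_locales (rule sub)
  \<comment> \<open>The defining property of the conditional expectation, tested with the constant
    1.\<close>
  have "(\<integral>\<^sup>+\<omega>. ennreal (f \<omega>) \<partial>M) = (\<integral>\<^sup>+\<omega>. nn_cond_exp M G (\<lambda>\<omega>. ennreal (f \<omega>)) \<omega> \<partial>M)"
    using nn_cond_exp_intg[of "\<lambda>_. 1" "\<lambda>\<omega>. ennreal (f \<omega>)"] by simp
  also have "\<dots> \<le> (\<integral>\<^sup>+\<omega>. ennreal c \<partial>M)"
    by (rule nn_integral_mono_AE) (rule bound)
  also have "\<dots> = ennreal c"
    by (simp add: emeasure_space_1)
  finally have le: "(\<integral>\<^sup>+\<omega>. ennreal (f \<omega>) \<partial>M) \<le> ennreal c" .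
  then have "(\<integral>\<^sup>+\<omega>. ennreal (f \<omega>) \<partial>M) < \<infinity>"
    using le_less_trans[OF _ ennreal_less_top] by simp
  then show int: "integrable M f"
    using nonneg(1) by (intro integrableI_nonneg) auto
  show "integral\<^sup>L M f \<le> c"
    using le nn_integral_eq_integral[OF int] nonneg by (simp add: ennreal_le_iff)
qed

lemma subalgebra_vimage_algebra:
  "f \<in> measurable M N \<Longrightarrow> subalgebra M (vimage_algebra (space M) f N)"
  using measurable_iff_sets[of f M N] by (auto simp: subalgebra_def)

text \<open>The method does not look ahead; independence of the sample \<open>\<xi>s k\<close> from
  \<open>u k\<close> and \<open>h k\<close> rests on this.\<close>

lemma popov_cong:
  "(\<And>j. j < k \<Longrightarrow> x j = y j) \<Longrightarrow> popov U \<Phi> \<alpha> u0 h0 x k = popov U \<Phi> \<alpha> u0 h0 y k"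
  by (induction k) (auto simp: Let_def split_beta)

section \<open>The random iteration: measurability and integrability\<close>

text \<open>\<open>S\<close> stands for the solution set. The parameters \<open>p\<close>,
  \<open>\<mu>\<close> and the diameter bound enter only through \<open>a\<close>, and the stepsizes
  are left open so that both rates share the one-step analysis.\<close>

locale stochastic_popov = prob_space M for M :: "'w measure" +
  fixes U S :: "(real^'m) set"
    and F :: "real^'m \<Rightarrow> real^'m"
    and \<Phi> :: "real^'m \<Rightarrow> real^'d \<Rightarrow> real^'m"
    and \<xi>s :: "nat \<Rightarrow> 'w \<Rightarrow> real^'d"
    and u0 h0 :: "real^'m"
    and a D :: real
    and \<alpha> :: "nat \<Rightarrow> real"
  assumes a_pos: "0 < a" and compact: "compact U" and convex: "convex U"
    and S_subset: "S \<subseteq> U" and closed_S: "closed S" and convex_S: "convex S" and S_nonempty: "S \<noteq> {}"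
    and start: "u0 \<in> U" "h0 \<in> U"
    and F_cont: "continuous_on U F"
    and F_bound: "\<And>v. v \<in> U \<Longrightarrow> norm (F v) \<le> D"
    and sharp: "\<And>v y. v \<in> U \<Longrightarrow> y \<in> S \<Longrightarrow> a * (infdist v S)\<^sup>2 \<le> F v \<bullet> (v - y)"
    and \<Phi>_meas: "(\<lambda>(v, x). \<Phi> v x) \<in> borel_measurable (restrict_space borel U \<Otimes>\<^sub>M borel)"
    and \<xi>s_meas [measurable]: "\<And>k. \<xi>s k \<in> borel_measurable M"
    and \<xi>s_indep: "indep_vars (\<lambda>_. borel) \<xi>s UNIV"
    and \<Phi>_int: "\<And>v k. v \<in> U \<Longrightarrow> integrable M (\<lambda>\<omega>. \<Phi> v (\<xi>s k \<omega>))"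
    and \<Phi>_mean: "\<And>v k. v \<in> U \<Longrightarrow> expectation (\<lambda>\<omega>. \<Phi> v (\<xi>s k \<omega>)) = F v"
begin

abbreviation "u k \<omega> \<equiv> popov_u U \<Phi> \<alpha> u0 h0 (\<lambda>j. \<xi>s j \<omega>) k"
abbreviation "h k \<omega> \<equiv> popov_h U \<Phi> \<alpha> u0 h0 (\<lambda>j. \<xi>s j \<omega>) k"
abbreviation "e k \<omega> \<equiv> \<Phi> (h k \<omega>) (\<xi>s k \<omega>) - F (h k \<omega>)"
abbreviation "y k \<omega> \<equiv> closest_point S (u k \<omega>)"
abbreviation "r k \<equiv> expectation (\<lambda>\<omega>. (infdist (u k \<omega>) S)\<^sup>2)"

lemma closed: "closed U"
  using compact by (rule compact_imp_closed)

lemma nonempty: "U \<noteq> {}"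
  using start by auto

lemma popov_in: "popov U \<Phi> \<alpha> u0 h0 x k \<in> U \<times> U"
  by (cases k) (auto simp: Let_def split_beta start closest_point_in_set[OF closed nonempty])

lemma u_in: "popov_u U \<Phi> \<alpha> u0 h0 x k \<in> U" and h_in: "popov_h U \<Phi> \<alpha> u0 h0 x k \<in> U"
  using popov_in[of x k] by (auto simp: popov_u_def popov_h_def)

lemma u_Suc: "u (Suc k) \<omega> = closest_point U (u k \<omega> - \<alpha> k *\<^sub>R \<Phi> (h k \<omega>) (\<xi>s k \<omega>))"
  and h_Suc: "h (Suc k) \<omega> = closest_point U (u (Suc k) \<omega> - \<alpha> (Suc k) *\<^sub>R \<Phi> (h k \<omega>) (\<xi>s k \<omega>))"
  by (simp_all add: popov_u_def popov_h_def Let_def split_beta)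

lemma measurable_F [measurable]: "F \<in> borel_measurable (restrict_space borel U)"
  using F_cont by (rule borel_measurable_continuous_on_restrict)

lemma measurable_closest_point:
  "closed A \<Longrightarrow> convex A \<Longrightarrow> A \<noteq> {} \<Longrightarrow> closest_point A \<in> borel_measurable borel" for A :: "(real^'m) set"
  by (intro borel_measurable_continuous_onI continuous_on_closest_point)

text \<open>\<open>F\<close> and \<open>\<Phi>\<close> are measurable only relative to
  \<open>U\<close>, so the projection, and with it \<open>h\<close>, is typed as a map into the
  restricted space.\<close>

lemma measurable_closest_point_U [measurable]: "closest_point U \<in> borel \<rightarrow>\<^sub>M restrict_space borel U"
  using closest_point_in_set[OF closed nonempty]
  by (intro measurable_restrict_space2 measurable_closest_point closed convex nonempty) auto

lemma measurable_closest_point_S [measurable]: "closest_point S \<in> borel_measurable borel"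
  by (intro measurable_closest_point closed_S convex_S S_nonempty)

lemma measurable_U_borel [measurable (raw)]:
  "f \<in> N \<rightarrow>\<^sub>M restrict_space borel U \<Longrightarrow> f \<in> borel_measurable N" for f :: "'z \<Rightarrow> real^'m"
  by (auto simp: measurable_restrict_space2_iff)

lemma measurable_\<Phi> [measurable (raw)]:
  assumes "f \<in> N \<rightarrow>\<^sub>M restrict_space borel U" "g \<in> borel_measurable N"
  shows "(\<lambda>z. \<Phi> (f z) (g z)) \<in> borel_measurable N"
  using measurable_compose[OF measurable_Pair[OF assms] \<Phi>_meas] by simp

text \<open>The source space is arbitrary because the lemma is used twice: on the probability space,
  and on the product space of the first \<open>k\<close> samples.\<close>

lemma measurable_popov:
  assumes "\<And>j. j < k \<Longrightarrow> x j \<in> borel_measurable N"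
  shows "(\<lambda>z. popov U \<Phi> \<alpha> u0 h0 (\<lambda>j. x j z) k) \<in> N \<rightarrow>\<^sub>M borel \<Otimes>\<^sub>M restrict_space borel U"
  using assms
proof (induction k)
  case 0
  then show ?case
    using start by (simp add: space_pair_measure space_restrict_space)
next
  case (Suc k)
  define g where "g = (\<lambda>z. popov U \<Phi> \<alpha> u0 h0 (\<lambda>j. x j z) k)"
  have [measurable]: "g \<in> N \<rightarrow>\<^sub>M borel \<Otimes>\<^sub>M restrict_space borel U" "x k \<in> borel_measurable N"
    using Suc by (auto simp: g_def)
  have eq: "popov U \<Phi> \<alpha> u0 h0 (\<lambda>j. x j z) (Suc k) =
     (let v = closest_point U (fst (g z) - \<alpha> k *\<^sub>R \<Phi> (snd (g z)) (x k z))
      in (v, closest_point U (v - \<alpha> (Suc k) *\<^sub>R \<Phi> (snd (g z)) (x k z))))" for z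
    by (simp add: g_def Let_def split_beta)
  show ?case
    unfolding eq Let_def by measurable
qed

lemma measurable_u [measurable]: "u k \<in> borel_measurable M"
  and measurable_h [measurable]: "h k \<in> M \<rightarrow>\<^sub>M restrict_space borel U"
proof -
  have [measurable]: "(\<lambda>\<omega>. popov U \<Phi> \<alpha> u0 h0 (\<lambda>j. \<xi>s j \<omega>) k) \<in> M \<rightarrow>\<^sub>M borel \<Otimes>\<^sub>M restrict_space borel U"
    by (rule measurable_popov) measurable
  show "u k \<in> borel_measurable M" "h k \<in> M \<rightarrow>\<^sub>M restrict_space borel U"
    unfolding popov_u_def popov_h_def by measurable
qed

lemma y_in: "y k \<omega> \<in> S"
  by (rule closest_point_in_set[OF closed_S S_nonempty])

lemma bounded_diff: obtains B where "\<And>v w. v \<in> U \<Longrightarrow> w \<in> U \<Longrightarrow> norm (v - w) \<le> B"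
  using diameter_bounded_bound[OF compact_imp_bounded[OF compact]]
  by (intro that[of "diameter U"]) (simp flip: dist_norm)

lemma integrable_infdist: "integrable M (\<lambda>\<omega>. (infdist (u k \<omega>) S)\<^sup>2)"
proof -
  obtain B where B: "\<And>v w. v \<in> U \<Longrightarrow> w \<in> U \<Longrightarrow> norm (v - w) \<le> B"
    using bounded_diff by blast
  have "infdist (u k \<omega>) S \<le> B" for \<omega>
    unfolding infdist_closest_point[OF closed_S S_nonempty] using y_in S_subset u_in by (blast intro: B)
  then show ?thesis
    by (intro integrable_const_bound[where B="B\<^sup>2"])
      (auto simp: infdist_nonneg power_mono infdist_closest_point[OF closed_S S_nonempty])
qed

section \<open>Moments of the noise\<close>

lemma
  assumes noise: "unbiased_bounded_noise M \<Phi> F \<sigma> (h k) (\<xi>s k)"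
  shows integrable_noise_sq: "integrable M (\<lambda>\<omega>. (norm (e k \<omega>))\<^sup>2)"
    and expectation_noise_sq: "expectation (\<lambda>\<omega>. (norm (e k \<omega>))\<^sup>2) \<le> \<sigma>\<^sup>2"
proof -
  have sub: "subalgebra M (vimage_algebra (space M) (h k) borel)"
    by (rule subalgebra_vimage_algebra) measurable
  have meas: "(\<lambda>\<omega>. (norm (e k \<omega>))\<^sup>2) \<in> borel_measurable M"
    by measurable
  have bound: "AE \<omega> in M. nn_cond_exp M (vimage_algebra (space M) (h k) borel)
      (\<lambda>\<omega>. ennreal ((norm (e k \<omega>))\<^sup>2)) \<omega> \<le> ennreal (\<sigma>\<^sup>2)"
    using noise unfolding unbiased_bounded_noise_def Let_def by (rule conjunct2)
  note * = nn_cond_exp_AE_bound[OF prob_space_axioms sub meas zero_le_power2 zero_le_power2 bound]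
  show "integrable M (\<lambda>\<omega>. (norm (e k \<omega>))\<^sup>2)"
    by (rule *(1))
  show "expectation (\<lambda>\<omega>. (norm (e k \<omega>))\<^sup>2) \<le> \<sigma>\<^sup>2"
    by (rule *(2))
qed

text \<open>The noise is square integrable and \<open>h k - y k\<close> is bounded by the
  compactness of \<open>U\<close>, so \<open>(norm (e k \<omega>))\<^sup>2 + B\<^sup>2\<close> is an
  integrable majorant.\<close>

lemma integrable_noise_inner:
  assumes noise: "unbiased_bounded_noise M \<Phi> F \<sigma> (h k) (\<xi>s k)"
  shows "integrable M (\<lambda>\<omega>. e k \<omega> \<bullet> (h k \<omega> - y k \<omega>))"
proof -
  obtain B where B: "\<And>v w. v \<in> U \<Longrightarrow> w \<in> U \<Longrightarrow> norm (v - w) \<le> B"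
    using bounded_diff by blast
  have bound: "norm (e k \<omega> \<bullet> (h k \<omega> - y k \<omega>)) \<le> norm ((norm (e k \<omega>))\<^sup>2 + B\<^sup>2)" for \<omega>
  proof -
    have "norm (e k \<omega> \<bullet> (h k \<omega> - y k \<omega>)) \<le> norm (e k \<omega>) * norm (h k \<omega> - y k \<omega>)"
      by (simp add: Cauchy_Schwarz_ineq2)
    also have "\<dots> \<le> norm (e k \<omega>) * B"
      using y_in S_subset h_in by (intro mult_left_mono B) auto
    also have "\<dots> \<le> (norm (e k \<omega>))\<^sup>2 + B\<^sup>2"
    proof -
      have "0 \<le> (norm (e k \<omega>))\<^sup>2 + B\<^sup>2" by simp
      then show ?thesis
        using sum_squares_bound[of "norm (e k \<omega>)" B] by linarith
    qed
    finally show ?thesis by simp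
  qed
  show ?thesis
  proof (rule Bochner_Integration.integrable_bound)
    show "integrable M (\<lambda>\<omega>. (norm (e k \<omega>))\<^sup>2 + B\<^sup>2)"
      by (intro Bochner_Integration.integrable_add integrable_noise_sq[OF noise] integrable_const)
    show "(\<lambda>\<omega>. e k \<omega> \<bullet> (h k \<omega> - y k \<omega>)) \<in> borel_measurable M"
      by measurable
    show "AE \<omega> in M. norm (e k \<omega> \<bullet> (h k \<omega> - y k \<omega>)) \<le> norm ((norm (e k \<omega>))\<^sup>2 + B\<^sup>2)"
      using bound by (rule AE_I2)
  qed
qed

text \<open>
  Conditioning on \<open>h k\<close> alone would not suffice here, since \<open>y k\<close> depends on \<open>u k\<close>; the independence of
  the samples is used instead of the conditional mean of the noise. Since \<^const>\<open>prob_space.indep_var\<close>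
  requires both variables to have the same type, the independent pair is the sample sequence restricted to
  \<open>{..<k}\<close> and to \<open>{k}\<close>.
\<close>

lemma expectation_noise_inner:
  assumes noise: "unbiased_bounded_noise M \<Phi> F \<sigma> (h k) (\<xi>s k)"
  shows "expectation (\<lambda>\<omega>. e k \<omega> \<bullet> (h k \<omega> - y k \<omega>)) = 0"
proof -
  define P where "P x = popov U \<Phi> \<alpha> u0 h0 x k" for x
  define f where "f = (\<lambda>(x, x'). (\<Phi> (snd (P x)) (x' k) - F (snd (P x)))
    \<bullet> (snd (P x) - closest_point S (fst (P x))))"
  define X where "X A \<omega> = restrict (\<lambda>j. \<xi>s j \<omega>) A" for A \<omega>
  have [measurable]: "P \<in> PiM {..<k} (\<lambda>_. borel) \<rightarrow>\<^sub>M borel \<Otimes>\<^sub>M restrict_space borel U"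
    unfolding P_def by (rule measurable_popov) auto
  \<comment> \<open>Restriction to \<open>{..<k}\<close> loses nothing, since \<open>P\<close> reads
    only these coordinates.\<close>
  have P_X: "P (X {..<k} \<omega>) = (u k \<omega>, h k \<omega>)" for \<omega>
    by (auto simp: P_def X_def popov_u_def popov_h_def intro!: popov_cong)
  then have f_X: "f (X {..<k} \<omega>, X {k} \<omega>) = e k \<omega> \<bullet> (h k \<omega> - y k \<omega>)" for \<omega>
    by (simp add: f_def X_def)
  have "expectation (\<lambda>\<omega>. f (X {..<k} \<omega>, X {k} \<omega>)) = 0"
  proof (rule expectation_indep_var_eq_0[OF prob_space_axioms])
    show "indep_var (PiM {..<k} (\<lambda>_. borel)) (X {..<k}) (PiM {k} (\<lambda>_. borel)) (X {k})"
      unfolding X_def by (rule indep_var_restrict[OF \<xi>s_indep]) auto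
    show "f \<in> borel_measurable (PiM {..<k} (\<lambda>_. borel) \<Otimes>\<^sub>M PiM {k} (\<lambda>_. borel))"
      unfolding f_def split_beta by measurable
    show "integrable M (\<lambda>\<omega>. f (X {..<k} \<omega>, X {k} \<omega>))"
      unfolding f_X by (rule integrable_noise_inner[OF noise])
    fix x :: "nat \<Rightarrow> real^'d"
    define v w where "v = fst (P x)" and "w = snd (P x)"
    have w: "w \<in> U"
      using popov_in[of x k] by (auto simp: w_def P_def)
    \<comment> \<open>With the past frozen at \<open>x\<close>, the second factor is a constant and
      the mean of \<open>\<Phi>\<close> at the fixed point \<open>w\<close> applies.\<close>
    have "expectation (\<lambda>\<omega>. (\<Phi> w (\<xi>s k \<omega>) - F w) \<bullet> (w - closest_point S v)) =
        expectation (\<lambda>\<omega>. \<Phi> w (\<xi>s k \<omega>) - F w) \<bullet> (w - closest_point S v)"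
      using \<Phi>_int[OF w] by (intro integral_inner_left) auto
    also have "expectation (\<lambda>\<omega>. \<Phi> w (\<xi>s k \<omega>) - F w) = 0"
      using \<Phi>_int[OF w] \<Phi>_mean[OF w] by (simp add: prob_space)
    finally show "expectation (\<lambda>\<omega>. f (x, X {k} \<omega>)) = 0"
      by (simp add: f_def v_def w_def X_def)
  qed
  then show ?thesis
    by (simp add: f_X)
qed

section \<open>The one-step recursion\<close>

text \<open>The index starts at 1 because \<open>h0\<close> is arbitrary: only from
  \<open>h 1\<close> on is \<open>h\<close> a projected step from \<open>u\<close> along the
  previous sample. Hence \<open>r 1\<close> appears in the rates.\<close>

lemma pathwise_step:
  assumes \<alpha>: "0 \<le> \<alpha> (Suc k)" "2 * a * \<alpha> (Suc k) \<le> 1"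
  shows "(infdist (u (Suc (Suc k)) \<omega>) S)\<^sup>2 \<le> (1 - a * \<alpha> (Suc k)) * (infdist (u (Suc k) \<omega>) S)\<^sup>2
    - 2 * \<alpha> (Suc k) * (e (Suc k) \<omega> \<bullet> (h (Suc k) \<omega> - y (Suc k) \<omega>))
    + 3 * (\<alpha> (Suc k))\<^sup>2 * ((norm (e (Suc k) \<omega>))\<^sup>2 + (norm (e k \<omega>))\<^sup>2 + 4 * D\<^sup>2)"
proof -
  define \<beta> where "\<beta> = \<alpha> (Suc k)"
  define v w z where "v = u (Suc k) \<omega>" and "w = h (Suc k) \<omega>" and "z = y (Suc k) \<omega>"
  define g g' where "g = \<Phi> w (\<xi>s (Suc k) \<omega>)" and "g' = \<Phi> (h k \<omega>) (\<xi>s k \<omega>)"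
  have mem: "z \<in> S" "z \<in> U" "w \<in> U" "h k \<omega> \<in> U"
    using y_in S_subset h_in by (auto simp: z_def w_def)
  have w: "w = closest_point U (v - \<beta> *\<^sub>R g')"
    unfolding w_def v_def g'_def \<beta>_def by (rule h_Suc)
  have u: "u (Suc (Suc k)) \<omega> = closest_point U (v - \<beta> *\<^sub>R g)"
    unfolding v_def g_def w_def \<beta>_def by (rule u_Suc)
  have "(infdist (u (Suc (Suc k)) \<omega>) S)\<^sup>2 \<le> (norm (u (Suc (Suc k)) \<omega> - z))\<^sup>2"
    using infdist_le[OF mem(1)] by (intro power_mono) (auto simp: dist_norm infdist_nonneg)
  also have "\<dots> \<le> (norm (v - z))\<^sup>2 - (norm (v - w))\<^sup>2 - 2 * \<beta> * (g \<bullet> (w - z))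
      + \<beta>\<^sup>2 * (norm (g - g'))\<^sup>2"
    by (rule popov_step_inequality[OF convex closed mem(2) w u])
  also have "(norm (v - z))\<^sup>2 = (infdist v S)\<^sup>2"
    by (simp add: infdist_closest_point[OF closed_S S_nonempty] v_def z_def)
  finally have 1: "(infdist (u (Suc (Suc k)) \<omega>) S)\<^sup>2 \<le> (infdist v S)\<^sup>2 - (norm (v - w))\<^sup>2
      - 2 * \<beta> * (g \<bullet> (w - z)) + \<beta>\<^sup>2 * (norm (g - g'))\<^sup>2" .
  have noise: "\<beta>\<^sup>2 * (norm (g - g'))\<^sup>2 \<le>
      \<beta>\<^sup>2 * (3 * ((norm (g - F w))\<^sup>2 + (norm (g' - F (h k \<omega>)))\<^sup>2 + 4 * D\<^sup>2))"
    using mem by (intro mult_left_mono norm_noise_difference_le F_bound) auto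
  have split: "2 * \<beta> * (g \<bullet> (w - z)) = 2 * \<beta> * ((g - F w) \<bullet> (w - z)) + 2 * \<beta> * (F w \<bullet> (w - z))"
    by (simp add: inner_diff_left algebra_simps)
  \<comment> \<open>Passing from the distance of \<open>w\<close> to that of \<open>v\<close> costs
    \<open>2 * a * \<beta> * (norm (v - w))\<^sup>2\<close>, which
    \<open>- (norm (v - w))\<^sup>2\<close> covers since
    \<open>2 * a * \<beta> \<le> 1\<close>.\<close>
  have "2 * \<beta> * (F w \<bullet> (w - z)) \<ge> 2 * \<beta> * (a * (infdist w S)\<^sup>2)"
    using \<alpha> mem by (intro mult_left_mono sharp) (auto simp: \<beta>_def)
  moreover have "a * \<beta> * (infdist v S)\<^sup>2 \<le> a * \<beta> * (2 * (infdist w S)\<^sup>2 + 2 * (norm (v - w))\<^sup>2)"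
    using \<alpha> a_pos by (intro mult_left_mono power2_infdist_le) (auto simp: \<beta>_def)
  moreover have "2 * a * \<beta> * (norm (v - w))\<^sup>2 \<le> 1 * (norm (v - w))\<^sup>2"
    using \<alpha> by (intro mult_right_mono) (auto simp: \<beta>_def)
  ultimately have drift: "(infdist v S)\<^sup>2 - (norm (v - w))\<^sup>2 - 2 * \<beta> * (F w \<bullet> (w - z))
      \<le> (1 - a * \<beta>) * (infdist v S)\<^sup>2"
    by (simp add: algebra_simps)
  have "(infdist (u (Suc (Suc k)) \<omega>) S)\<^sup>2 \<le> (1 - a * \<beta>) * (infdist v S)\<^sup>2 - 2 * \<beta> * ((g - F w) \<bullet> (w - z))
      + 3 * \<beta>\<^sup>2 * ((norm (g - F w))\<^sup>2 + (norm (g' - F (h k \<omega>)))\<^sup>2 + 4 * D\<^sup>2)"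
    using 1 noise drift unfolding split by linarith
  then show ?thesis
    unfolding \<beta>_def v_def w_def z_def g_def g'_def .
qed

text \<open>Both samples \<open>k\<close> and \<open>Suc k\<close> contribute a variance of at most
  \<open>\<sigma>\<^sup>2\<close>, and \<open>3 * (2 * \<sigma>\<^sup>2 + 4 * D\<^sup>2)\<close> is
  \<open>6 * (\<sigma>\<^sup>2 + 2 * D\<^sup>2)\<close>.\<close>

lemma expected_step:
  assumes \<alpha>: "0 \<le> \<alpha> (Suc k)" "2 * a * \<alpha> (Suc k) \<le> 1"
    and noise: "unbiased_bounded_noise M \<Phi> F \<sigma> (h k) (\<xi>s k)"
      "unbiased_bounded_noise M \<Phi> F \<sigma> (h (Suc k)) (\<xi>s (Suc k))"
  shows "r (Suc (Suc k)) \<le> (1 - a * \<alpha> (Suc k)) * r (Suc k) + 6 * (\<alpha> (Suc k))\<^sup>2 * (\<sigma>\<^sup>2 + 2 * D\<^sup>2)"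
proof -
  note int = integrable_infdist integrable_noise_inner[OF noise(2)]
    integrable_noise_sq[OF noise(1)] integrable_noise_sq[OF noise(2)]
  have "r (Suc (Suc k)) \<le> expectation (\<lambda>\<omega>. (1 - a * \<alpha> (Suc k)) * (infdist (u (Suc k) \<omega>) S)\<^sup>2
    - 2 * \<alpha> (Suc k) * (e (Suc k) \<omega> \<bullet> (h (Suc k) \<omega> - y (Suc k) \<omega>))
    + 3 * (\<alpha> (Suc k))\<^sup>2 * ((norm (e (Suc k) \<omega>))\<^sup>2 + (norm (e k \<omega>))\<^sup>2 + 4 * D\<^sup>2))"
    using int by (intro integral_mono pathwise_step \<alpha>) auto
  also have "\<dots> = (1 - a * \<alpha> (Suc k)) * r (Suc k)
    + 3 * (\<alpha> (Suc k))\<^sup>2 * (expectation (\<lambda>\<omega>. (norm (e (Suc k) \<omega>))\<^sup>2)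
        + expectation (\<lambda>\<omega>. (norm (e k \<omega>))\<^sup>2) + 4 * D\<^sup>2)"
    using int by (simp add: expectation_noise_inner[OF noise(2)] prob_space)
  also have "\<dots> \<le> (1 - a * \<alpha> (Suc k)) * r (Suc k) + 3 * (\<alpha> (Suc k))\<^sup>2 * (\<sigma>\<^sup>2 + \<sigma>\<^sup>2 + 4 * D\<^sup>2)"
    by (intro add_left_mono mult_left_mono add_mono expectation_noise_sq noise order_refl) auto
  finally show ?thesis
    by (simp add: algebra_simps)
qed

lemma r_nonneg: "0 \<le> r k"
  by (rule Bochner_Integration.integral_nonneg) simp

section \<open>The two convergence rates\<close>

lemma rate_decreasing_stepsize:
  assumes K: "2 \<le> K"
    and \<alpha>: "\<And>k. k \<le> K \<Longrightarrow> \<alpha> k = 2 / (a * (3 + real k))"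
    and noise: "\<And>k. k \<le> K \<Longrightarrow> unbiased_bounded_noise M \<Phi> F \<sigma> (h k) (\<xi>s k)"
  shows "r (K + 1) \<le> 32 / (real K - 1)\<^sup>2 * r 1 + 24 * (\<sigma>\<^sup>2 + 2 * D\<^sup>2) / (a\<^sup>2 * (real K - 1))"
proof -
  define C where "C = 24 * (\<sigma>\<^sup>2 + 2 * D\<^sup>2) / a\<^sup>2"
  define x where "x = real K - 1"
  have C: "0 \<le> C" and x: "1 \<le> x"
    using K by (auto simp: C_def x_def)
  have "(real (K - 1) + 3) * (real (K - 1) + 4) * r (Suc (Suc (K - 1))) \<le> 6 * r (Suc 0) + C * (real (K - 1) + 1)"
  \<comment> \<open>Shifted to start at \<open>r 1\<close>. At \<open>j = 0\<close> the stepsize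
    gives \<open>2 * a * \<alpha> 1 = 1\<close>, the largest value that the one-step recursion
    admits.\<close>
  proof (rule harmonic_recursion[where s = "\<lambda>j. r (Suc j)", OF _ C])
    fix j assume j: "j \<le> K - 1"
    then have \<alpha>j: "\<alpha> (Suc j) = 2 / (a * (real j + 4))"
      using \<alpha>[of "Suc j"] K by (simp add: add_ac)
    have "r (Suc (Suc j)) \<le> (1 - a * \<alpha> (Suc j)) * r (Suc j) + 6 * (\<alpha> (Suc j))\<^sup>2 * (\<sigma>\<^sup>2 + 2 * D\<^sup>2)"
      using j K a_pos by (intro expected_step noise) (auto simp: \<alpha>j)
    then show "r (Suc (Suc j)) \<le> (1 - 2 / (real j + 4)) * r (Suc j) + C / (real j + 4)\<^sup>2"
      using a_pos by (simp add: \<alpha>j C_def power_divide power_mult_distrib)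
  qed
  moreover have "Suc (Suc (K - 1)) = K + 1" "real (K - 1) = x"
    using K by (auto simp: x_def)
  ultimately have main: "(x + 3) * (x + 4) * r (K + 1) \<le> 6 * r 1 + C * (x + 1)"
    by (simp only: One_nat_def)
  have "r (K + 1) \<le> (6 * r 1 + C * (x + 1)) / ((x + 3) * (x + 4))"
    using main x by (simp add: pos_le_divide_eq mult_ac)
  also have "\<dots> = 6 / ((x + 3) * (x + 4)) * r 1 + C * ((x + 1) / ((x + 3) * (x + 4)))"
    by (simp only: add_divide_distrib[of "6 * r 1"] times_divide_eq_left times_divide_eq_right)
  also have "\<dots> \<le> 32 / x\<^sup>2 * r 1 + C * (1 / x)"
  proof (intro add_mono mult_right_mono mult_left_mono C r_nonneg)
    show "6 / ((x + 3) * (x + 4)) \<le> 32 / x\<^sup>2"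
      using x by (intro frac_le) (auto simp: power2_eq_square algebra_simps)
    have "(x + 1) * x \<le> (x + 3) * (x + 4)"
      using x by (simp add: algebra_simps)
    then show "(x + 1) / ((x + 3) * (x + 4)) \<le> 1 / x"
      using x by (simp add: divide_simps)
  qed
  finally show ?thesis
    by (simp add: C_def x_def)
qed

lemma rate_adK_stepsize:
  assumes K: "2 \<le> K"
    and \<alpha>: "\<And>k. k \<le> K \<Longrightarrow> \<alpha> k = adK_stepsize a (2 * a) K k"
    and noise: "\<And>k. k \<le> K \<Longrightarrow> unbiased_bounded_noise M \<Phi> F \<sigma> (h k) (\<xi>s k)"
  shows "r (K + 1) \<le> 64 * r 1 * exp (- ((real K - 1) / 4)) + 432 * (\<sigma>\<^sup>2 + 2 * D\<^sup>2) / (a\<^sup>2 * (real K - 1))"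
proof -
  define c where "c = (\<sigma>\<^sup>2 + 2 * D\<^sup>2) / a\<^sup>2"
  have c: "0 \<le> c" by (simp add: c_def)
  define k0 where "k0 = nat \<lceil>real K / 2\<rceil>"
  have k0: "real K / 2 \<le> real k0" "real k0 < real K / 2 + 1"
    unfolding k0_def using K by linarith+
  \<comment> \<open>The recursion starts at index 1, so the constant phase yields
    \<open>q = k0 - 1\<close> halvings, from \<open>r 1\<close> to \<open>r k0\<close>.\<close>
  define q where "q = k0 - 1"
  have q: "k0 = Suc q"
    using k0 K by (simp add: q_def)
  have q_bounds: "real K / 2 - 1 \<le> real q" "real q < real K / 2"
    using k0 by (auto simp: q)
  \<comment> \<open>Here \<open>d / a = 2\<close>, so for \<open>K \<ge> 2\<close> the stepsize is
    constant throughout exactly when \<open>K = 2\<close>.\<close>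
  have \<alpha>': "\<alpha> k = (if K = 2 \<or> k \<le> q then 1 / (2 * a) else 2 / (a * (4 + real k - real k0)))"
    if "k \<le> K" for k
    using \<alpha>[OF that] a_pos K by (auto simp: adK_stepsize_def Let_def k0_def[symmetric] q)
  have const_step: "r (Suc (Suc j)) \<le> r (Suc j) / 2 + 3 / 2 * c"
    if "Suc j \<le> K" "K = 2 \<or> Suc j \<le> q" for j
  proof -
    have \<alpha>j: "\<alpha> (Suc j) = 1 / (2 * a)"
      using \<alpha>'[OF that(1)] that(2) by simp
    have "r (Suc (Suc j)) \<le> (1 - a * \<alpha> (Suc j)) * r (Suc j) + 6 * (\<alpha> (Suc j))\<^sup>2 * (\<sigma>\<^sup>2 + 2 * D\<^sup>2)"
      using that a_pos by (intro expected_step noise) (auto simp: \<alpha>j)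
    then show ?thesis
      using a_pos by (simp add: \<alpha>j c_def power_divide power_mult_distrib)
  qed
  \<comment> \<open>Since \<open>q / 2\<close> is at least \<open>(K - 1) / 4 - 1 / 4\<close>, the
    loss is a factor \<open>exp (1 / 4)\<close>, at most 2.\<close>
  have exp_q: "(1 / 2) ^ q \<le> 2 * exp (- ((real K - 1) / 4))"
  proof -
    have "(1 / 2) ^ q \<le> exp (- (real q / 2))"
      by (rule half_power_le_exp)
    also have "\<dots> \<le> exp (1 / 4 + - ((real K - 1) / 4))"
      using q_bounds by (simp add: field_simps)
    also have "\<dots> = exp (1 / 4) * exp (- ((real K - 1) / 4))"
      by (rule exp_add)
    also have "exp (1 / 4 :: real) \<le> 2"
      using exp_bound_half[of "1/4::real"] by simp
    finally show ?thesis by simp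
  qed
  have "r (K + 1) \<le> 64 * r 1 * exp (- ((real K - 1) / 4)) + 48 * c / (real K - 1)"
  proof (cases "K = 2")
    case True
    have "r 2 \<le> r 1 / 2 + 3 / 2 * c" "r 3 \<le> r 2 / 2 + 3 / 2 * c"
      using const_step[of 0] const_step[of 1] True by (simp_all add: numeral_eq_Suc)
    moreover have "r 1 * (3 / 4) \<le> r 1 * exp (- (1 / 4))"
      using exp_ge_add_one_self[of "- (1 / 4)"] by (intro mult_left_mono r_nonneg) auto
    ultimately have "r 3 \<le> 64 * (r 1 * exp (- (1 / 4))) + 48 * c"
      using c r_nonneg[of 1] by linarith
    then show ?thesis
      using True by (simp add: mult_ac)
  next
    case False
    define x where "x = real (K - k0)"
    have "k0 \<le> K"
      using k0 K by linarith
    then have x: "x = real K - real k0" "0 \<le> x"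
      by (auto simp: x_def)
    have "r (Suc q) \<le> r (Suc 0) / 2 ^ q + 2 * (3 / 2 * c) * (1 - 1 / 2 ^ q)"
      using q_bounds K by (intro geometric_recursion[where s = "\<lambda>j. r (Suc j)"] const_step) auto
    also have "\<dots> \<le> r (Suc 0) / 2 ^ q + 2 * (3 / 2 * c) * 1"
      using c by (intro add_left_mono mult_left_mono) auto
    also have "r (Suc 0) / 2 ^ q = r 1 * (1 / 2) ^ q"
      by (simp add: power_divide)
    also have "\<dots> \<le> r 1 * (2 * exp (- ((real K - 1) / 4)))"
      by (intro mult_left_mono exp_q r_nonneg)
    finally have first_phase: "r (Suc q) \<le> 2 * r 1 * exp (- ((real K - 1) / 4)) + 3 * c"
      by simp
    \<comment> \<open>Second phase: at index \<open>k0\<close>, that is \<open>j = 0\<close>, the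
      stepsize is \<open>2 / (a * 4)\<close>, so the harmonic recursion applies and its
      \<open>K - k0 + 1\<close> steps end at \<open>r (K + 1)\<close>.\<close>
    have "(real (K - k0) + 3) * (real (K - k0) + 4) * r (Suc (q + Suc (K - k0)))
        \<le> 6 * r (Suc (q + 0)) + 24 * c * (real (K - k0) + 1)"
    proof (rule harmonic_recursion[where s = "\<lambda>j. r (Suc (q + j))"])
      fix j assume j: "j \<le> K - k0"
      then have le: "Suc (q + j) \<le> K"
        using \<open>k0 \<le> K\<close> q by simp
      have \<alpha>j: "\<alpha> (Suc (q + j)) = 2 / (a * (real j + 4))"
        using \<alpha>'[OF le] False by (simp add: q add_ac)
      have "r (Suc (Suc (q + j))) \<le> (1 - a * \<alpha> (Suc (q + j))) * r (Suc (q + j))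
          + 6 * (\<alpha> (Suc (q + j)))\<^sup>2 * (\<sigma>\<^sup>2 + 2 * D\<^sup>2)"
        using le a_pos by (intro expected_step noise) (auto simp: \<alpha>j)
      then show "r (Suc (q + Suc j)) \<le> (1 - 2 / (real j + 4)) * r (Suc (q + j)) + 24 * c / (real j + 4)\<^sup>2"
        using a_pos by (simp add: \<alpha>j c_def power_divide power_mult_distrib)
    qed (use c in simp)
    moreover have "Suc (q + Suc (K - k0)) = K + 1"
      using \<open>k0 \<le> K\<close> q by simp
    ultimately have "(x + 3) * (x + 4) * r (K + 1) \<le> 6 * r (Suc q) + 24 * c * (x + 1)"
      by (simp add: x_def)
    \<comment> \<open>The residual \<open>18 * c\<close> of the first phase is absorbed by enlarging
      \<open>x + 1\<close> to \<open>x + 4\<close>, which then cancels in the quotient.\<close>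
    also have "\<dots> \<le> 12 * (r 1 * exp (- ((real K - 1) / 4))) + 24 * c * (x + 4)"
      using first_phase c by (simp add: algebra_simps)
    finally have "r (K + 1) \<le> (12 * (r 1 * exp (- ((real K - 1) / 4))) + 24 * c * (x + 4)) / ((x + 3) * (x + 4))"
      using x by (simp add: pos_le_divide_eq mult_ac)
    also have "\<dots> = 12 / ((x + 3) * (x + 4)) * (r 1 * exp (- ((real K - 1) / 4))) + c * (24 / (x + 3))"
      using x by (simp add: add_divide_distrib)
    also have "\<dots> \<le> 64 * (r 1 * exp (- ((real K - 1) / 4))) + c * (48 / (real K - 1))"
    proof (intro add_mono mult_right_mono mult_left_mono c)
      have "12 \<le> (x + 3) * (x + 4)"
        using x by (simp add: algebra_simps)
      then show "12 / ((x + 3) * (x + 4)) \<le> 64"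
        by (simp add: divide_simps)
      \<comment> \<open>The second phase covers about half of the iterations: \<open>x\<close>
        exceeds \<open>K / 2 - 1\<close>, so \<open>2 * (x + 3)\<close> exceeds
        \<open>K - 1\<close>.\<close>
      show "24 / (x + 3) \<le> 48 / (real K - 1)"
        using x k0 K by (simp add: divide_simps)
    qed (simp add: r_nonneg)
    finally show ?thesis
      by (simp add: mult_ac)
  qed
  also have "48 * c / (real K - 1) \<le> 432 * c / (real K - 1)"
    using c K by (intro divide_right_mono) auto
  finally show ?thesis
    by (simp add: c_def)
qed

end

section \<open>Instantiation with the variational inequality\<close>

lemmas rates = stochastic_popov.rate_decreasing_stepsize stochastic_popov.rate_adK_stepsize

lemma quasi_sharp_convex_solutions:
  assumes "convex U" "continuous_on U F" "0 \<le> \<mu>" and qs: "quasi_sharp p \<mu> U (VI_solutions U F) F"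
  shows "convex (VI_solutions U F)"
proof (rule convex_VI_solutions[OF assms(1,2)])
  fix v y assume "v \<in> U" "y \<in> VI_solutions U F"
  then have "\<mu> * infdist v (VI_solutions U F) powr p \<le> F v \<bullet> (v - y)"
    using qs by (auto simp: quasi_sharp_def)
  moreover have "0 \<le> \<mu> * infdist v (VI_solutions U F) powr p"
    using \<open>0 \<le> \<mu>\<close> by simp
  ultimately show "0 \<le> F v \<bullet> (v - y)" by linarith
qed

text \<open>The distance to \<open>S\<close> is at most \<open>m\<close> because \<open>S\<close>
  lies in \<open>U\<close>, so the exponent can be raised to 2. This is the origin of the constant
  \<open>a\<close>.\<close>

lemma quasi_sharp_quadratic:
  assumes qs: "quasi_sharp p \<mu> U S F" and "S \<subseteq> U"
    and diam: "\<And>u u'. u \<in> U \<Longrightarrow> u' \<in> U \<Longrightarrow> norm (u - u') \<le> m" and "0 < m" "p \<le> 2" "0 \<le> \<mu>"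
    and v: "v \<in> U" and y: "y \<in> S"
  shows "\<mu> / m powr (2 - p) * (infdist v S)\<^sup>2 \<le> F v \<bullet> (v - y)"
proof -
  have "infdist v S \<le> norm (v - y)"
    using infdist_le[OF y, of v] by (simp add: dist_norm)
  also have "\<dots> \<le> m"
    using v y \<open>S \<subseteq> U\<close> by (intro diam) auto
  finally have "\<mu> / m powr (2 - p) * (infdist v S)\<^sup>2
      \<le> \<mu> / m powr (2 - p) * (infdist v S powr p * m powr (2 - p))"
    using \<open>p \<le> 2\<close> \<open>0 \<le> \<mu>\<close>
    by (intro mult_left_mono power2_le_powr_mult_powr) (auto simp: infdist_nonneg)
  also have "\<dots> = \<mu> * infdist v S powr p"
    using \<open>0 < m\<close> by simp
  also have "\<dots> \<le> F v \<bullet> (v - y)"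
    using qs v y by (auto simp: quasi_sharp_def)
  finally show ?thesis .
qed

lemma same_distr_expectation:
  fixes f :: "'b::topological_space \<Rightarrow> 'c::{banach, second_countable_topology}"
  assumes "distr M borel X = distr M borel Y"
    and [measurable]: "f \<in> borel_measurable borel" "X \<in> borel_measurable M" "Y \<in> borel_measurable M"
  shows "integrable M (\<lambda>\<omega>. f (X \<omega>)) \<longleftrightarrow> integrable M (\<lambda>\<omega>. f (Y \<omega>))"
    and "(\<integral>\<omega>. f (X \<omega>) \<partial>M) = (\<integral>\<omega>. f (Y \<omega>) \<partial>M)"
  using assms(1) by (simp_all flip: integrable_distr_eq[of _ M borel] integral_distr[of _ M borel])

lemma measurable_section:
  assumes "(\<lambda>(v, x). \<Phi> v x) \<in> borel_measurable (restrict_space borel U \<Otimes>\<^sub>M borel)" "v \<in> U"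
  shows "\<Phi> v \<in> borel_measurable borel"
  using measurable_compose[OF measurable_Pair[OF measurable_const measurable_ident] assms(1), of v] assms(2)
  by (simp add: space_restrict_space)

text \<open>Translates the noise terms of the rates, expressed through \<open>a\<close>, back to
  \<open>\<mu>\<close> and the diameter bound.\<close>

lemma mult_div_power2_div:
  "0 < m \<Longrightarrow> n / ((\<mu> / m powr q)\<^sup>2 * x) = n * m powr (2 * q) / (\<mu>\<^sup>2 * x)" for m n x \<mu> q :: real
proof -
  assume "0 < m"
  have "m powr (2 * q) = (m powr q)\<^sup>2"
    by (simp add: power2_eq_square flip: powr_add)
  then show ?thesis
    using \<open>0 < m\<close> by (simp add: power_divide)
qed

theorem theorem3p8:
  fixes M :: "'w measure"
    and U :: "(real^'m) set"
    and F :: "real^'m \<Rightarrow> real^'m"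
    and \<Phi> :: "real^'m \<Rightarrow> real^'d \<Rightarrow> real^'m"
    and \<xi> :: "'w \<Rightarrow> real^'d"
    and \<xi>s :: "nat \<Rightarrow> 'w \<Rightarrow> real^'d"
    and u0 h0 :: "real^'m"
    and M\<^sub>U D \<sigma> \<mu> p :: real
  defines "Ustar \<equiv> VI_solutions U F"
  assumes "prob_space M"
    and "U \<noteq> {}" and "compact U" and "convex U"
    and "(\<lambda>(v, x). \<Phi> v x) \<in> borel_measurable (restrict_space borel U \<Otimes>\<^sub>M borel)"
    and "\<xi> \<in> borel_measurable M"
    and "\<And>u. u \<in> U \<Longrightarrow> integrable M (\<lambda>\<omega>. \<Phi> u (\<xi> \<omega>))"
    and "\<And>u. u \<in> U \<Longrightarrow> F u = prob_space.expectation M (\<lambda>\<omega>. \<Phi> u (\<xi> \<omega>))"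
    and "continuous_on U F"
    and "Ustar \<noteq> {}" and "closed Ustar"
    and "M\<^sub>U > 0" and "D > 0"
    and "\<And>u u'. u \<in> U \<Longrightarrow> u' \<in> U \<Longrightarrow> norm (u - u') \<le> M\<^sub>U"
    and "\<And>u. u \<in> U \<Longrightarrow> norm (F u) \<le> D"
    and "\<And>k. \<xi>s k \<in> borel_measurable M"
    and "\<And>k. distr M borel (\<xi>s k) = distr M borel \<xi>"
    and "prob_space.indep_vars M (\<lambda>_. borel) \<xi>s UNIV"
    and "u0 \<in> U" and "h0 \<in> U"
    and "\<sigma> > 0"
    and "0 < p" and "p \<le> 2" and "\<mu> > 0"
    and "quasi_sharp p \<mu> U Ustar F"
  shows
    "(\<forall>\<alpha> :: nat \<Rightarrow> real.
        let u = (\<lambda>k \<omega>. popov_u U \<Phi> \<alpha> u0 h0 (\<lambda>j. \<xi>s j \<omega>) k);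
            h = (\<lambda>k \<omega>. popov_h U \<Phi> \<alpha> u0 h0 (\<lambda>j. \<xi>s j \<omega>) k)
        in (\<forall>k. \<alpha> k = 2 * M\<^sub>U powr (2 - p) / (\<mu> * (3 + real k))) \<longrightarrow>
           (\<forall>k. unbiased_bounded_noise M \<Phi> F \<sigma> (h k) (\<xi>s k)) \<longrightarrow>
           (\<forall>K\<ge>2.
              prob_space.expectation M (\<lambda>\<omega>. (infdist (u (K + 1) \<omega>) Ustar)\<^sup>2)
              \<le> 32 / (real K - 1)\<^sup>2
                  * prob_space.expectation M (\<lambda>\<omega>. (infdist (u 1 \<omega>) Ustar)\<^sup>2)
                + 24 * (\<sigma>\<^sup>2 + 2 * D\<^sup>2) * M\<^sub>U powr (2 * (2 - p)) / (\<mu>\<^sup>2 * (real K - 1))))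
     \<and>
     (\<forall>K\<ge>2. \<forall>\<alpha> :: nat \<Rightarrow> real.
        let u = (\<lambda>k \<omega>. popov_u U \<Phi> \<alpha> u0 h0 (\<lambda>j. \<xi>s j \<omega>) k);
            h = (\<lambda>k \<omega>. popov_h U \<Phi> \<alpha> u0 h0 (\<lambda>j. \<xi>s j \<omega>) k)
        in (\<forall>k\<le>K. \<alpha> k = adK_stepsize (\<mu> / M\<^sub>U powr (2 - p)) (2 * \<mu> / M\<^sub>U powr (2 - p)) K k) \<longrightarrow>
           (\<forall>k\<le>K. unbiased_bounded_noise M \<Phi> F \<sigma> (h k) (\<xi>s k)) \<longrightarrow>
           prob_space.expectation M (\<lambda>\<omega>. (infdist (u (K + 1) \<omega>) Ustar)\<^sup>2)
           \<le> 64 * prob_space.expectation M (\<lambda>\<omega>. (infdist (u 1 \<omega>) Ustar)\<^sup>2)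
                 * exp (- ((real K - 1) / 4))
             + 432 * (\<sigma>\<^sup>2 + 2 * D\<^sup>2) * M\<^sub>U powr (2 * (2 - p)) / (\<mu>\<^sup>2 * (real K - 1)))"
proof -
  define a where "a = \<mu> / M\<^sub>U powr (2 - p)"
  have sub: "Ustar \<subseteq> U"
    by (auto simp: assms(1) VI_solutions_def)
  have a: "0 < a"
    using \<open>M\<^sub>U > 0\<close> \<open>\<mu> > 0\<close> by (simp add: a_def)
  have convex: "convex Ustar"
    unfolding assms(1)
    using assms(5,10) less_imp_le[OF \<open>\<mu> > 0\<close>] assms(26)[unfolded assms(1)]
    by (rule quasi_sharp_convex_solutions)
  have sharp: "a * (infdist v Ustar)\<^sup>2 \<le> F v \<bullet> (v - y)" if "v \<in> U" "y \<in> Ustar" for v y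
    unfolding a_def
    by (rule quasi_sharp_quadratic[OF assms(26) sub _ \<open>M\<^sub>U > 0\<close> \<open>p \<le> 2\<close> less_imp_le[OF \<open>\<mu> > 0\<close>] that])
      (rule assms(15))
  \<comment> \<open>All samples share the law of \<open>\<xi>\<close>, so integrability and mean
    transfer from \<open>\<xi>\<close> to each \<open>\<xi>s k\<close>.\<close>
  have int: "integrable M (\<lambda>\<omega>. \<Phi> v (\<xi>s k \<omega>))"
    and mean: "prob_space.expectation M (\<lambda>\<omega>. \<Phi> v (\<xi>s k \<omega>)) = F v" if v: "v \<in> U" for v k
    using same_distr_expectation[OF assms(18) measurable_section[OF assms(6) v] assms(17) assms(7)]
      assms(8,9)[OF v] by simp_all
  have popov: "stochastic_popov M U Ustar F \<Phi> \<xi>s u0 h0 a D"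
    by (intro stochastic_popov.intro stochastic_popov_axioms.intro)
      (fact assms a sub convex sharp int mean)+
  note rate = mult_div_power2_div[OF \<open>M\<^sub>U > 0\<close>, of _ \<mu> "2 - p", folded a_def]
  show ?thesis
    unfolding Let_def
  proof (intro conjI allI impI)
    fix \<alpha> :: "nat \<Rightarrow> real" and K :: nat
    assume \<alpha>: "\<forall>k. \<alpha> k = 2 * M\<^sub>U powr (2 - p) / (\<mu> * (3 + real k))" and K: "2 \<le> K"
      and noise: "\<forall>k. unbiased_bounded_noise M \<Phi> F \<sigma>
        (\<lambda>\<omega>. popov_h U \<Phi> \<alpha> u0 h0 (\<lambda>j. \<xi>s j \<omega>) k) (\<xi>s k)"
    have "\<alpha> k = 2 / (a * (3 + real k))" for k
      using \<alpha> by (simp add: a_def)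
    from rates(1)[OF popov K this noise[rule_format]]
    show "prob_space.expectation M (\<lambda>\<omega>. (infdist (popov_u U \<Phi> \<alpha> u0 h0 (\<lambda>j. \<xi>s j \<omega>) (K + 1)) Ustar)\<^sup>2)
        \<le> 32 / (real K - 1)\<^sup>2
            * prob_space.expectation M (\<lambda>\<omega>. (infdist (popov_u U \<Phi> \<alpha> u0 h0 (\<lambda>j. \<xi>s j \<omega>) 1) Ustar)\<^sup>2)
          + 24 * (\<sigma>\<^sup>2 + 2 * D\<^sup>2) * M\<^sub>U powr (2 * (2 - p)) / (\<mu>\<^sup>2 * (real K - 1))"
      by (simp only: rate)
  next
    fix \<alpha> :: "nat \<Rightarrow> real" and K :: nat
    assume \<alpha>: "\<forall>k\<le>K. \<alpha> k = adK_stepsize (\<mu> / M\<^sub>U powr (2 - p)) (2 * \<mu> / M\<^sub>U powr (2 - p)) K k"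
      and K: "2 \<le> K"
      and noise: "\<forall>k\<le>K. unbiased_bounded_noise M \<Phi> F \<sigma>
        (\<lambda>\<omega>. popov_h U \<Phi> \<alpha> u0 h0 (\<lambda>j. \<xi>s j \<omega>) k) (\<xi>s k)"
    have "\<alpha> k = adK_stepsize a (2 * a) K k" if "k \<le> K" for k
      using \<alpha> that by (simp add: a_def)
    from rates(2)[OF popov K this noise[rule_format]]
    show "prob_space.expectation M (\<lambda>\<omega>. (infdist (popov_u U \<Phi> \<alpha> u0 h0 (\<lambda>j. \<xi>s j \<omega>) (K + 1)) Ustar)\<^sup>2)
        \<le> 64
            * prob_space.expectation M (\<lambda>\<omega>. (infdist (popov_u U \<Phi> \<alpha> u0 h0 (\<lambda>j. \<xi>s j \<omega>) 1) Ustar)\<^sup>2)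
            * exp (- ((real K - 1) / 4))
          + 432 * (\<sigma>\<^sup>2 + 2 * D\<^sup>2) * M\<^sub>U powr (2 * (2 - p)) / (\<mu>\<^sup>2 * (real K - 1))"
      by (simp only: rate)
  qed
qed

end
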